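(* Let $A\in\mathbb{R}^{m\times n}$, let $I\subseteq\{1,\dots,m\}$ and $J\subseteq\{1,\dots,n\}$ be sets of row and column indices with $|I|=|J|=k\le\operatorname{rank}(A)$, and let $X\in\mathbb{R}^{k\times n}$ be any matrix (a row space approximator of $A$). Assume that $A(I,J)\in\mathbb{R}^{k\times k}$ is nonsingular and that $X(:,J)\in\mathbb{R}^{k\times k}$ has full row rank. Let $I_0\subseteq\{1,\dots,m\}$ be a set of extra row indices disjoint from $I$ with $|I_0|=p$, and let $$A_{I\cup I_0,J}=A(:,J)\,A(I\cup I_0,J)^\dagger\,A(I\cup I_0,:).$$ Let $Q_C\in\mathbb{R}^{m\times k}$ and $Q_X\in\mathbb{R}^{n\times k}$ be matrices with orthonormal columns spanning the column spaces of $C=A(:,J)$ and $X^T$, respectively. Then for any unitarily invariant norm $\|\cdot\|$, $$\|A-A_{I\cup I_0,J}\|\le\|Q_C(I\cup I_0,:)^\dagger\|_2\,\|Q_X(J,:)^{-1}\|_2\,\|A-AX^\dagger X\|.$$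
   Context: $A(I,J)$ is the submatrix of $A$ with rows $I$ and columns $J$; $A(:,J)$ and $A(I,:)$ are the submatrices of columns $J$ and rows $I$. $\dagger$ is the Moore–Penrose pseudoinverse and $\|\cdot\|_2$ the spectral norm. *)

theory Defs
  imports
    Complex_Main
    "Jordan_Normal_Form.DL_Rank_Submatrix"
    "Jordan_Normal_Form.Gauss_Jordan_Elimination"
begin

text \<open>Rows and columns are numbered from \<open>0\<close>. Thus \<open>submatrix A I J\<close>, \<open>submatrix A UNIV J\<close> and
  \<open>submatrix A I UNIV\<close> are \<open>A(I,J)\<close>, \<open>A(:,J)\<close> and \<open>A(I,:)\<close>, with the selected rows and columns
  taken in increasing order of their indices.\<close>

definition is_pinv :: "real mat \<Rightarrow> real mat \<Rightarrow> bool" where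
  "is_pinv A B \<longleftrightarrow> B \<in> carrier_mat (dim_col A) (dim_row A) \<and>
     A * B * A = A \<and> B * A * B = B \<and>
     transpose_mat (A * B) = A * B \<and> transpose_mat (B * A) = B * A"

text \<open>The Penrose conditions above determine the Moore--Penrose pseudoinverse uniquely.\<close>

definition pinv :: "real mat \<Rightarrow> real mat" where
  "pinv A = (THE B. is_pinv A B)"

definition euclid_norm :: "real vec \<Rightarrow> real" where
  "euclid_norm v = sqrt (v \<bullet> v)"

text \<open>The supremum is over the closed unit ball rather than the unit sphere, so that the set is
  nonempty even for a matrix without columns.\<close>

definition spectral_norm :: "real mat \<Rightarrow> real" where
  "spectral_norm A =
     (SUP v \<in> {v \<in> carrier_vec (dim_col A). euclid_norm v \<le> 1}. euclid_norm (A *\<^sub>v v))"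

text \<open>Unlike the library's \<open>orthogonal_mat\<close>, this normalises the columns, and the matrix may be
  rectangular.\<close>

definition orthonormal_cols :: "real mat \<Rightarrow> bool" where
  "orthonormal_cols Q \<longleftrightarrow> transpose_mat Q * Q = 1\<^sub>m (dim_col Q)"

text \<open>For real matrices, unitary invariance is invariance under square orthogonal factors; a
  square matrix is orthogonal iff its columns are orthonormal. The values of \<open>N\<close> outside
  \<open>carrier_mat m n\<close> are irrelevant.\<close>

definition unitarily_invariant_norm :: "nat \<Rightarrow> nat \<Rightarrow> (real mat \<Rightarrow> real) \<Rightarrow> bool" where
  "unitarily_invariant_norm m n N \<longleftrightarrow>
     (\<forall>A \<in> carrier_mat m n. 0 \<le> N A \<and> (N A = 0 \<longleftrightarrow> A = 0\<^sub>m m n)) \<and>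
     (\<forall>c. \<forall>A \<in> carrier_mat m n. N (c \<cdot>\<^sub>m A) = \<bar>c\<bar> * N A) \<and>
     (\<forall>A \<in> carrier_mat m n. \<forall>B \<in> carrier_mat m n. N (A + B) \<le> N A + N B) \<and>
     (\<forall>U \<in> carrier_mat m m. \<forall>V \<in> carrier_mat n n. \<forall>A \<in> carrier_mat m n.
        orthonormal_cols U \<longrightarrow> orthonormal_cols V \<longrightarrow> N (U * A * V) = N A)"

text \<open>\<open>A(:,J) A(R,J)\<^sup>\<dagger> A(R,:)\<close>, for row indices \<open>R\<close> and column indices \<open>J\<close>.\<close>

definition cross_approx :: "real mat \<Rightarrow> nat set \<Rightarrow> nat set \<Rightarrow> real mat" where
  "cross_approx A R J = submatrix A UNIV J * pinv (submatrix A R J) * submatrix A R UNIV"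

end

theory Submission
  imports Defs
begin

text \<open>With \<open>C = A(:,J)\<close>, \<open>S = I \<union> I\<^sub>0\<close> and the selection matrices \<open>P\<^sub>S\<close>, \<open>P\<^sub>J\<close>, the cross approximation is
  \<open>D A\<close> for the oblique projector \<open>D = Q\<^sub>C Q\<^sub>C(S,:)\<^sup>\<dagger> P\<^sub>S\<close>, which fixes \<open>C\<close>.  The oblique projector
  \<open>E = P\<^sub>J\<^sup>T Q\<^sub>X(J,:)\<^sup>-\<^sup>T Q\<^sub>X\<^sup>T\<close> satisfies \<open>X E = X\<close>, and the columns of \<open>A E\<close> lie in the column space
  of \<open>C\<close>.  Hence \<open>A - D A = (1 - D) (A - A X\<^sup>\<dagger> X) (1 - E)\<close>.  For a nonzero projector \<open>P\<close> one has
  \<open>\<parallel>1 - P\<parallel>\<^sub>2 \<le> \<parallel>P\<parallel>\<^sub>2\<close>, and \<open>\<parallel>L F R\<parallel> \<le> \<parallel>L\<parallel>\<^sub>2 \<parallel>F\<parallel> \<parallel>R\<parallel>\<^sub>2\<close> for a unitarily invariant norm because every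
  contraction is a convex combination of orthogonal matrices.\<close>

section \<open>Convex combinations of orthogonal matrices\<close>

text \<open>Squared lengths are compared, so that the condition says exactly that
  \<open>defect_form B\<close> is positive semidefinite.\<close>

definition contraction :: "real mat \<Rightarrow> bool" where
  "contraction B \<longleftrightarrow> (\<forall>x \<in> carrier_vec (dim_col B). (B *\<^sub>v x) \<bullet> (B *\<^sub>v x) \<le> x \<bullet> x)"

text \<open>The bilinear form of \<open>1 - B^T B\<close>. For a square matrix it vanishes
  identically exactly when the matrix is orthogonal.\<close>

definition defect_form :: "real mat \<Rightarrow> real vec \<Rightarrow> real vec \<Rightarrow> real" where
  "defect_form B x y = x \<bullet> y - (B *\<^sub>v x) \<bullet> (B *\<^sub>v y)"

lemma scalar_prod_self_nonneg: "0 \<le> (v :: real vec) \<bullet> v"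
  by (auto simp: scalar_prod_def intro: sum_nonneg)

lemma scalar_prod_self_eq_0:
  fixes v :: "real vec"
  shows "v \<in> carrier_vec n \<Longrightarrow> v \<bullet> v = 0 \<longleftrightarrow> v = 0\<^sub>v n"
  by (auto simp: scalar_prod_def sum_nonneg_eq_0_iff)

lemma scalar_prod_self_pos:
  fixes v :: "real vec"
  shows "v \<in> carrier_vec n \<Longrightarrow> v \<noteq> 0\<^sub>v n \<Longrightarrow> 0 < v \<bullet> v"
  using scalar_prod_self_nonneg[of v] scalar_prod_self_eq_0[of v n] by auto

lemma defect_form_nonneg:
  assumes "B \<in> carrier_mat m m" "contraction B" "x \<in> carrier_vec m"
  shows "0 \<le> defect_form B x x"
  using assms by (auto simp: contraction_def defect_form_def)

lemma defect_form_add_smult: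
  assumes B[simp]: "B \<in> carrier_mat m m" and [simp]: "x \<in> carrier_vec m" "y \<in> carrier_vec m"
  shows "defect_form B (x + t \<cdot>\<^sub>v y) (x + t \<cdot>\<^sub>v y) =
    defect_form B x x + 2 * t * defect_form B x y + t\<^sup>2 * defect_form B y y"
proof -
  have sq: "(u + t \<cdot>\<^sub>v v) \<bullet> (u + t \<cdot>\<^sub>v v) = u \<bullet> u + 2 * t * (u \<bullet> v) + t\<^sup>2 * (v \<bullet> v)"
    if [simp]: "u \<in> carrier_vec m" "v \<in> carrier_vec m" for u v :: "real vec"
    by (simp add: add_scalar_prod_distrib[of _ m] scalar_prod_add_distrib[of _ m]
        comm_scalar_prod[of v m u] power2_eq_square algebra_simps
        smult_scalar_prod_distrib[of _ m] scalar_prod_smult_distrib[of _ m])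
  show ?thesis
    by (simp add: defect_form_def mult_add_distrib_mat_vec[of _ m m] mult_mat_vec[of _ m m] sq
        mult_mat_vec_carrier[OF B] algebra_simps)
qed

text \<open>The form is only semidefinite, so the discriminant argument along the line
  \<open>x + t y\<close> has to treat a vanishing quadratic coefficient separately.\<close>

lemma defect_form_Cauchy_Schwarz:
  assumes B: "B \<in> carrier_mat m m" "contraction B"
    and x: "x \<in> carrier_vec m" and y: "y \<in> carrier_vec m"
  shows "(defect_form B x y)\<^sup>2 \<le> defect_form B x x * defect_form B y y"
proof -
  define b where "b = defect_form B x y"
  define d where "d = defect_form B y y"
  define a where "a = defect_form B x x"
  have pos: "0 \<le> a + 2 * t * b + t\<^sup>2 * d" for t
    using defect_form_nonneg[OF B, of "x + t \<cdot>\<^sub>v y"] x y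
    by (simp add: defect_form_add_smult[OF B(1)] a_def b_def d_def)
  have d0: "0 \<le> d" unfolding d_def by (rule defect_form_nonneg[OF B y])
  have "b\<^sup>2 \<le> a * d"
  proof (cases "d = 0")
    case True
    have "b = 0"
    proof (rule ccontr)
      assume "b \<noteq> 0"
      \<comment> \<open>Here the polynomial is \<open>a + 2 * t * b\<close>, and this
        \<open>t\<close> gives it the value -1.\<close>
      then show False using pos[of "- (a + 1) / (2 * b)"] True by (simp add: field_simps)
    qed
    then show ?thesis using True by simp
  next
    case False
    then have "0 < d" using d0 by simp
    \<comment> \<open>The polynomial is evaluated at its minimiser, where it equals
      \<open>a - b^2 / d\<close>.\<close>
    then show ?thesis using pos[of "- b / d"] by (simp add: field_simps power2_eq_square)
  qed
  then show ?thesis by (simp add: a_def b_def d_def)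
qed

lemma smult_mat_mult_vec:
  fixes A :: "'a :: comm_ring_1 mat"
  assumes "A \<in> carrier_mat nr nc" "v \<in> carrier_vec nc"
  shows "(c \<cdot>\<^sub>m A) *\<^sub>v v = c \<cdot>\<^sub>v (A *\<^sub>v v)"
  using assms
  by (intro eq_vecI)
    (auto simp: scalar_prod_def sum_distrib_left mult.assoc carrier_matD carrier_vecD intro!: sum.cong)

definition rank_one :: "real vec \<Rightarrow> real vec \<Rightarrow> real mat" where
  "rank_one a g = mat (dim_vec a) (dim_vec g) (\<lambda>(i, j). a $ i * g $ j)"

lemma rank_one_carrier [simp]:
  "a \<in> carrier_vec m \<Longrightarrow> g \<in> carrier_vec n \<Longrightarrow> rank_one a g \<in> carrier_mat m n"
  by (auto simp: rank_one_def)

lemma rank_one_mult_vec: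
  assumes "a \<in> carrier_vec m" "g \<in> carrier_vec n" "x \<in> carrier_vec n"
  shows "rank_one a g *\<^sub>v x = (g \<bullet> x) \<cdot>\<^sub>v a"
  using assms
  by (intro eq_vecI) (auto simp: rank_one_def scalar_prod_def row_def sum_distrib_left algebra_simps)

text \<open>Since \<open>a \<bullet> B x = \<theta> (g \<bullet> x)\<close>, adding
  \<open>c a g^T\<close> to \<open>B\<close> adds
  \<open>(c^2 (a \<bullet> a) + 2 c \<theta>) g g^T\<close> to \<open>B^T B\<close>. The equation
  for \<open>c\<close> makes this exactly \<open>g g^T\<close>.\<close>

lemma defect_form_rank_one_update:
  assumes B[simp]: "B \<in> carrier_mat m m" and [simp]: "a \<in> carrier_vec m" "g \<in> carrier_vec m"
    and a: "transpose_mat B *\<^sub>v a = \<theta> \<cdot>\<^sub>v g" and c: "c\<^sup>2 * (a \<bullet> a) + 2 * c * \<theta> = 1"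
    and [simp]: "x \<in> carrier_vec m" "y \<in> carrier_vec m"
  shows "defect_form (B + c \<cdot>\<^sub>m rank_one a g) x y = defect_form B x y - (g \<bullet> x) * (g \<bullet> y)"
proof -
  have aB: "a \<bullet> (B *\<^sub>v z) = \<theta> * (g \<bullet> z)" if [simp]: "z \<in> carrier_vec m" for z
    using transpose_vec_mult_scalar[OF B that, of a] by (simp add: a smult_scalar_prod_distrib[of _ m])
  have Ba: "(B *\<^sub>v z) \<bullet> a = \<theta> * (g \<bullet> z)" if [simp]: "z \<in> carrier_vec m" for z
    using aB[OF that] comm_scalar_prod[of "B *\<^sub>v z" m a] mult_mat_vec_carrier[OF B that] by simp
  have mv: "(B + c \<cdot>\<^sub>m rank_one a g) *\<^sub>v z = B *\<^sub>v z + (c * (g \<bullet> z)) \<cdot>\<^sub>v a"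
    if [simp]: "z \<in> carrier_vec m" for z
  proof -
    have "(c \<cdot>\<^sub>m rank_one a g) *\<^sub>v z = c \<cdot>\<^sub>v (rank_one a g *\<^sub>v z)"
      by (rule smult_mat_mult_vec[of _ m m]) auto
    then show ?thesis
      by (simp add: add_mult_distrib_mat_vec[of _ m m] rank_one_mult_vec[of _ m _ m] smult_smult_assoc)
  qed
  have "((B + c \<cdot>\<^sub>m rank_one a g) *\<^sub>v x) \<bullet> ((B + c \<cdot>\<^sub>m rank_one a g) *\<^sub>v y) =
      (B *\<^sub>v x) \<bullet> (B *\<^sub>v y) + (c\<^sup>2 * (a \<bullet> a) + 2 * c * \<theta>) * ((g \<bullet> x) * (g \<bullet> y))"
    by (simp add: mv add_scalar_prod_distrib[of _ m] scalar_prod_add_distrib[of _ m] aB Ba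
        mult_mat_vec_carrier[OF B]
        smult_scalar_prod_distrib[of _ m] scalar_prod_smult_distrib[of _ m]
        power2_eq_square algebra_simps)
  then show ?thesis by (simp add: defect_form_def c)
qed

text \<open>Supplies the direction \<open>a\<close> of the rank-one update: a kernel vector of the
  transpose with \<open>\<theta> = 0\<close> when \<open>B\<close> is singular, otherwise the
  preimage of \<open>g\<close> with \<open>\<theta> = 1\<close>.\<close>

lemma transpose_kernel_or_preimage:
  assumes B: "B \<in> carrier_mat m m" and g: "(g :: real vec) \<in> carrier_vec m" "g \<noteq> 0\<^sub>v m"
  obtains a \<theta> where "a \<in> carrier_vec m" "a \<noteq> 0\<^sub>v m" "transpose_mat B *\<^sub>v a = \<theta> \<cdot>\<^sub>v g"
proof (cases "det (transpose_mat B) = 0")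
  case True
  have "\<exists>v. v \<in> carrier_vec m \<and> v \<noteq> 0\<^sub>v m \<and> transpose_mat B *\<^sub>v v = 0\<^sub>v m"
    using B True det_0_iff_vec_prod_zero[of "transpose_mat B" m] by simp
  moreover have "0 \<cdot>\<^sub>v g = 0\<^sub>v m" using g by auto
  ultimately show ?thesis using that[of _ 0] by metis
next
  case False
  obtain L where L: "L \<in> carrier_mat m m" "transpose_mat B * L = 1\<^sub>m m"
    using det_non_zero_imp_unit[OF _ False, of m] B
    by (auto simp: Units_def ring_mat_def)
  have "transpose_mat B *\<^sub>v (L *\<^sub>v g) = 1 \<cdot>\<^sub>v g"
    using L B g by (simp flip: assoc_mult_mat_vec[of _ m m _ m])
  moreover have "L *\<^sub>v g \<noteq> 0\<^sub>v m"
  proof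
    assume "L *\<^sub>v g = 0\<^sub>v m"
    then have "transpose_mat B *\<^sub>v (L *\<^sub>v g) = 0\<^sub>v m"
      using B by (auto intro!: eq_vecI simp: scalar_prod_def)
    then show False using calculation g by simp
  qed
  ultimately show ?thesis using that[of "L *\<^sub>v g" 1] L g by simp
qed

text \<open>The product of the two roots is \<open>- 1 / \<alpha>\<close>, hence negative. Opposite
  signs will place \<open>B\<close> between its two updates.\<close>

lemma opposite_roots:
  fixes \<alpha> \<theta> :: real
  assumes "0 < \<alpha>"
  obtains c d where "0 < c" "d < 0" "c\<^sup>2 * \<alpha> + 2 * c * \<theta> = 1" "d\<^sup>2 * \<alpha> + 2 * d * \<theta> = 1"
proof -
  define s where "s = sqrt (\<theta>\<^sup>2 + \<alpha>)"
  have s: "s * s = \<theta>\<^sup>2 + \<alpha>" using assms by (simp add: s_def)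
  have "\<bar>\<theta>\<bar> < s" using assms unfolding s_def by (intro real_less_rsqrt) simp
  then have lt: "\<theta> < s" "- s < \<theta>" by auto
  \<comment> \<open>\<open>e\<close> is the sign in front of the square root, taken as 1 and -1
    below.\<close>
  have "((- \<theta> + e * s) / \<alpha>)\<^sup>2 * \<alpha> + 2 * ((- \<theta> + e * s) / \<alpha>) * \<theta> = 1" if "e * e = 1" for e
  proof -
    have "(- \<theta> + e * s)\<^sup>2 + 2 * (- \<theta> + e * s) * \<theta> = (e * e) * (s * s) - \<theta>\<^sup>2"
      by (simp add: power2_eq_square algebra_simps)
    then have eq: "(- \<theta> + e * s)\<^sup>2 + 2 * (- \<theta> + e * s) * \<theta> = \<alpha>" by (simp add: that s)
    have "((- \<theta> + e * s) / \<alpha>)\<^sup>2 * \<alpha> + 2 * ((- \<theta> + e * s) / \<alpha>) * \<theta>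
        = ((- \<theta> + e * s)\<^sup>2 + 2 * (- \<theta> + e * s) * \<theta>) / \<alpha>"
      using assms by (simp add: power2_eq_square add_divide_distrib)
    then show ?thesis using eq assms by simp
  qed
  from this[of 1] this[of "-1"] show ?thesis
    using that[of "(- \<theta> + s) / \<alpha>" "(- \<theta> - s) / \<alpha>"] assms lt
    by (simp add: divide_less_0_iff)
qed

text \<open>Every contraction is a convex combination of orthogonal matrices.  If \<open>G = 1 - B\<^sup>T B\<close> does not
  annihilate \<open>e\<^sub>j\<close>, then \<open>B\<close> lies between two contractions with defect \<open>G - g g\<^sup>T\<close>, where
  \<open>g = G e\<^sub>j / sqrt G\<^sub>j\<^sub>j\<close>; this new defect annihilates \<open>e\<^sub>j\<close> and everything that \<open>G\<close> annihilates.\<close>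

lemma contraction_induct [consumes 2, case_names convex orthogonal]:
  assumes B: "B \<in> carrier_mat m m" "contraction B"
    and convex: "\<And>B C t. B \<in> carrier_mat m m \<Longrightarrow> C \<in> carrier_mat m m \<Longrightarrow> P B \<Longrightarrow> P C \<Longrightarrow>
      0 \<le> t \<Longrightarrow> t \<le> 1 \<Longrightarrow> P (t \<cdot>\<^sub>m B + (1 - t) \<cdot>\<^sub>m C)"
    and orthogonal: "\<And>B. B \<in> carrier_mat m m \<Longrightarrow> orthonormal_cols B \<Longrightarrow> P B"
  shows "P B"
proof -
  \<comment> \<open>Downward induction on \<open>j\<close>: the condition that the defect
    annihilates the first \<open>j\<close> unit vectors amounts to orthogonality for
    \<open>j = m\<close> and is empty for \<open>j = 0\<close>.\<close>
  have "\<forall>B \<in> carrier_mat m m. contraction B \<longrightarrow>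
    (\<forall>i<j. \<forall>y \<in> carrier_vec m. defect_form B y (unit_vec m i) = 0) \<longrightarrow> P B" if "j \<le> m" for j
    using that
  proof (induction rule: inc_induct)
    case base
    show ?case
    proof (intro ballI impI)
      fix B assume B: "B \<in> carrier_mat m m"
        and G: "\<forall>i<m. \<forall>y \<in> carrier_vec m. defect_form B y (unit_vec m i) = 0"
      have "transpose_mat B * B = 1\<^sub>m m"
      proof (rule eq_matI)
        fix i j assume ij: "i < dim_row (1\<^sub>m m :: real mat)" "j < dim_col (1\<^sub>m m :: real mat)"
        have "col B i = B *\<^sub>v unit_vec m i" if "i < m" for i
          using B that by (auto intro!: eq_vecI)
        moreover have "defect_form B (unit_vec m i) (unit_vec m j) = 0" using G ij by simp
        ultimately show "(transpose_mat B * B) $$ (i, j) = (1\<^sub>m m :: real mat) $$ (i, j)"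
          using B ij by (auto simp: defect_form_def)
      qed (use B in auto)
      then show "P B" using B by (intro orthogonal) (auto simp: orthonormal_cols_def)
    qed
  next
    case (step j)
    let ?e = "unit_vec m j :: real vec"
    have j: "j < m" using step by simp
    show ?case
    proof (intro ballI impI)
      fix B assume B[simp]: "B \<in> carrier_mat m m" and cB: "contraction B"
        and G: "\<forall>i<j. \<forall>y \<in> carrier_vec m. defect_form B y (unit_vec m i) = 0"
      note Bc[simp] = mult_mat_vec_carrier[OF B]
      define d where "d = defect_form B ?e ?e"
      have d0: "0 \<le> d" unfolding d_def by (rule defect_form_nonneg[OF B cB]) simp
      show "P B"
      proof (cases "d = 0")
        case True
        \<comment> \<open>Cauchy-Schwarz with \<open>d = 0\<close> shows that the defect already
          annihilates \<open>?e\<close>, so \<open>B\<close> itself falls under the induction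
          hypothesis.\<close>
        then have "defect_form B y ?e = 0" if "y \<in> carrier_vec m" for y
          using defect_form_Cauchy_Schwarz[OF B cB that unit_vec_carrier[of m j]] by (simp add: d_def)
        then show ?thesis using step.IH B cB G by (auto simp: less_Suc_eq)
      next
        case False
        then have d: "0 < d" using d0 by simp
        define g where "g = (1 / sqrt d) \<cdot>\<^sub>v (?e - transpose_mat B *\<^sub>v (B *\<^sub>v ?e))"
        have g[simp]: "g \<in> carrier_vec m"
          unfolding g_def carrier_vec_def using carrier_matD[OF B] by simp
        have gy: "g \<bullet> y = defect_form B y ?e / sqrt d" if [simp]: "y \<in> carrier_vec m" for y
        proof -
          have [simp]: "transpose_mat B *\<^sub>v (B *\<^sub>v ?e) \<in> carrier_vec m"
            by (intro mult_mat_vec_carrier[of _ m m]) auto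
          have "(transpose_mat B *\<^sub>v (B *\<^sub>v ?e)) \<bullet> y = (B *\<^sub>v ?e) \<bullet> (B *\<^sub>v y)"
            by (rule transpose_vec_mult_scalar[of _ m m]) auto
          also have "\<dots> = (B *\<^sub>v y) \<bullet> (B *\<^sub>v ?e)" by (rule comm_scalar_prod[of _ m]) auto
          finally have "(?e - transpose_mat B *\<^sub>v (B *\<^sub>v ?e)) \<bullet> y = defect_form B y ?e"
            using comm_scalar_prod[of ?e m y]
            by (simp add: minus_scalar_prod_distrib[of _ m] defect_form_def)
          then show ?thesis by (simp add: g_def smult_scalar_prod_distrib[of _ m])
        qed
        have "g \<noteq> 0\<^sub>v m"
        proof
          assume "g = 0\<^sub>v m"
          then show False using gy[of ?e] d by (simp flip: d_def)
        qed
        from transpose_kernel_or_preimage[OF B g this] obtain a \<theta>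
          where a: "a \<in> carrier_vec m" "a \<noteq> 0\<^sub>v m" "transpose_mat B *\<^sub>v a = \<theta> \<cdot>\<^sub>v g" .
        have "0 < a \<bullet> a" by (rule scalar_prod_self_pos[OF a(1,2)])
        from opposite_roots[OF this] obtain c c'
          where c: "0 < c" "c' < 0" "c\<^sup>2 * (a \<bullet> a) + 2 * c * \<theta> = 1"
            "c'\<^sup>2 * (a \<bullet> a) + 2 * c' * \<theta> = 1" .
        have P: "P (B + b \<cdot>\<^sub>m rank_one a g)" if b: "b\<^sup>2 * (a \<bullet> a) + 2 * b * \<theta> = 1" for b
        proof -
          let ?B = "B + b \<cdot>\<^sub>m rank_one a g"
          note upd = defect_form_rank_one_update[OF B a(1) g a(3) b]
          have carr[simp]: "?B \<in> carrier_mat m m" using a g by auto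
          have "0 \<le> defect_form ?B x x" if x[simp]: "x \<in> carrier_vec m" for x
          proof -
            \<comment> \<open>As \<open>g \<bullet> x = defect_form B x ?e / sqrt d\<close>, this is
              Cauchy-Schwarz against \<open>?e\<close>. It keeps the updated defect
              nonnegative.\<close>
            have "(g \<bullet> x) * (g \<bullet> x) \<le> defect_form B x x"
              using defect_form_Cauchy_Schwarz[OF B cB x unit_vec_carrier[of m j]] d
              by (simp add: gy power2_eq_square field_simps flip: d_def)
            then show ?thesis by (simp add: upd)
          qed
          then have "contraction ?B"
            unfolding contraction_def defect_form_def using carr by fastforce
          moreover have "defect_form ?B y (unit_vec m i) = 0"
            if "i < Suc j" and y[simp]: "y \<in> carrier_vec m" for i y
          proof (cases "i = j")
            case True
            have "(g \<bullet> y) * (g \<bullet> ?e) = defect_form B y ?e * d / (sqrt d * sqrt d)"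
              by (simp only: gy[OF y] gy[OF unit_vec_carrier] flip: d_def) simp
            also have "\<dots> = defect_form B y ?e" using d by simp
            finally show ?thesis using True by (simp add: upd)
          next
            case False
            then have "i < j" using that by simp
            then have z: "defect_form B z (unit_vec m i) = 0" if "z \<in> carrier_vec m" for z
              using G that by simp
            \<comment> \<open>By symmetry of the form, \<open>g\<close> is orthogonal to the unit
              vectors annihilated earlier, so the update does not spoil them.\<close>
            have "defect_form B (unit_vec m i) ?e = defect_form B ?e (unit_vec m i)"
              using comm_scalar_prod[of "B *\<^sub>v unit_vec m i" m "B *\<^sub>v ?e"]
                comm_scalar_prod[of "unit_vec m i :: real vec" m ?e]
              by (simp add: defect_form_def)
            then have "g \<bullet> unit_vec m i = 0" by (simp add: gy z)
            then show ?thesis by (simp add: upd z)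
          qed
          ultimately show ?thesis using step.IH carr by blast
        qed
        \<comment> \<open>The weight for which the two rank-one terms cancel. It lies in [0, 1]
          because \<open>c\<close> and \<open>c'\<close> have opposite signs.\<close>
        define t where "t = - c' / (c - c')"
        have t: "0 \<le> t" "t \<le> 1" "t * c + (1 - t) * c' = 0"
          using c by (auto simp: t_def field_simps)
        have "P (t \<cdot>\<^sub>m (B + c \<cdot>\<^sub>m rank_one a g) + (1 - t) \<cdot>\<^sub>m (B + c' \<cdot>\<^sub>m rank_one a g))"
          by (rule convex) (use P c t a in auto)
        also have "t \<cdot>\<^sub>m (B + c \<cdot>\<^sub>m rank_one a g) + (1 - t) \<cdot>\<^sub>m (B + c' \<cdot>\<^sub>m rank_one a g) = B"
        proof (rule eq_matI)
          fix i k assume "i < dim_row B" "k < dim_col B"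
          moreover have "t * (x + c * r) + (1 - t) * (x + c' * r) = x" for x r
          proof -
            have "t * (x + c * r) + (1 - t) * (x + c' * r) = x + r * (t * c + (1 - t) * c')"
              by (simp add: algebra_simps)
            then show ?thesis by (simp only: t(3))
          qed
          ultimately show "(t \<cdot>\<^sub>m (B + c \<cdot>\<^sub>m rank_one a g) + (1 - t) \<cdot>\<^sub>m (B + c' \<cdot>\<^sub>m rank_one a g))
            $$ (i, k) = B $$ (i, k)"
            using a B by (simp add: rank_one_def carrier_vecD[OF g] carrier_matD)
        qed (use a in \<open>auto simp: rank_one_def carrier_vecD[OF g] carrier_matD[OF B]\<close>)
        finally show ?thesis .
      qed
    qed
  qed
  from this[of 0] B show ?thesis by simp
qed

section \<open>Spectral and unitarily invariant norms\<close>

lemma smult_zero_vec: "c \<cdot>\<^sub>v 0\<^sub>v n = (0\<^sub>v n :: 'a :: mult_zero vec)"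
  by (intro eq_vecI) auto

lemma euclid_norm_nonneg: "0 \<le> euclid_norm v"
  by (simp add: euclid_norm_def scalar_prod_self_nonneg)

lemma euclid_norm_smult: "euclid_norm (c \<cdot>\<^sub>v v) = \<bar>c\<bar> * euclid_norm v"
  by (simp add: euclid_norm_def real_sqrt_mult mult.assoc[symmetric] real_sqrt_abs2)

lemma euclid_norm_pos: "v \<in> carrier_vec n \<Longrightarrow> v \<noteq> 0\<^sub>v n \<Longrightarrow> 0 < euclid_norm v"
  by (simp add: euclid_norm_def scalar_prod_self_pos)

text \<open>Needed for the supremum in \<open>spectral_norm\<close> to be an upper bound.
  Coordinates of \<open>v\<close> are at most 1 in absolute value, so each entry of
  \<open>A v\<close> is bounded by an absolute row sum.\<close>

lemma spectral_norm_bdd_above: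
  "bdd_above ((\<lambda>v. euclid_norm (A *\<^sub>v v)) ` {v \<in> carrier_vec (dim_col A). euclid_norm v \<le> 1})"
proof (rule bdd_aboveI2)
  fix v assume "v \<in> {v \<in> carrier_vec (dim_col A). euclid_norm v \<le> 1}"
  then have v: "dim_vec v = dim_col A" "(\<Sum>i<dim_col A. (v $ i)\<^sup>2) \<le> 1"
    by (auto simp: euclid_norm_def scalar_prod_def power2_eq_square lessThan_atLeast0)
  have v1: "\<bar>v $ j\<bar> \<le> 1" if "j < dim_col A" for j
  proof -
    have "(v $ j)\<^sup>2 \<le> (\<Sum>i<dim_col A. (v $ i)\<^sup>2)" by (rule member_le_sum) (use that in auto)
    then have "(v $ j)\<^sup>2 \<le> 1" using v(2) by simp
    then show ?thesis by (simp add: abs_square_le_1)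
  qed
  have "\<bar>(A *\<^sub>v v) $ i\<bar> \<le> (\<Sum>j<dim_col A. \<bar>A $$ (i, j)\<bar>)" if "i < dim_row A" for i
  proof -
    have "(A *\<^sub>v v) $ i = (\<Sum>j<dim_col A. A $$ (i, j) * v $ j)"
      using that v by (simp add: scalar_prod_def lessThan_atLeast0)
    also have "\<bar>\<dots>\<bar> \<le> (\<Sum>j<dim_col A. \<bar>A $$ (i, j) * v $ j\<bar>)" by (rule sum_abs)
    also have "\<dots> \<le> (\<Sum>j<dim_col A. \<bar>A $$ (i, j)\<bar>)"
      by (rule sum_mono) (use v1 in \<open>auto simp: abs_mult intro: mult_left_le\<close>)
    finally show ?thesis .
  qed
  then have "((A *\<^sub>v v) $ i)\<^sup>2 \<le> (\<Sum>j<dim_col A. \<bar>A $$ (i, j)\<bar>)\<^sup>2" if "i < dim_row A" for i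
    using that by (simp add: abs_le_square_iff[symmetric] abs_of_nonneg sum_nonneg)
  then have "(A *\<^sub>v v) \<bullet> (A *\<^sub>v v) \<le> (\<Sum>i<dim_row A. (\<Sum>j<dim_col A. \<bar>A $$ (i, j)\<bar>)\<^sup>2)"
    unfolding scalar_prod_def
    by (auto simp: power2_eq_square lessThan_atLeast0 simp del: index_mult_mat_vec intro!: sum_mono)
  then show "euclid_norm (A *\<^sub>v v) \<le> sqrt (\<Sum>i<dim_row A. (\<Sum>j<dim_col A. \<bar>A $$ (i, j)\<bar>)\<^sup>2)"
    by (simp add: euclid_norm_def)
qed

lemma euclid_norm_mult_le_spectral_norm:
  assumes "A \<in> carrier_mat m n" "v \<in> carrier_vec n"
  shows "euclid_norm (A *\<^sub>v v) \<le> spectral_norm A * euclid_norm v"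
proof (cases "v = 0\<^sub>v n")
  case True
  have "A *\<^sub>v 0\<^sub>v n = 0\<^sub>v m" using assms by (intro eq_vecI) auto
  then show ?thesis using True by (simp add: euclid_norm_def)
next
  case False
  define r where "r = euclid_norm v"
  have r: "0 < r" using euclid_norm_pos[OF assms(2) False] by (simp add: r_def)
  have "euclid_norm ((1 / r) \<cdot>\<^sub>v v) = 1" using r by (simp add: euclid_norm_smult flip: r_def)
  then have "euclid_norm (A *\<^sub>v ((1 / r) \<cdot>\<^sub>v v)) \<le> spectral_norm A"
    unfolding spectral_norm_def using assms by (intro cSUP_upper spectral_norm_bdd_above) auto
  moreover have "A *\<^sub>v ((1 / r) \<cdot>\<^sub>v v) = (1 / r) \<cdot>\<^sub>v (A *\<^sub>v v)" by (rule mult_mat_vec[OF assms])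
  ultimately show ?thesis using r by (simp add: euclid_norm_smult r_def[symmetric] divide_le_eq)
qed

lemma spectral_norm_nonneg: "0 \<le> spectral_norm A"
proof -
  have "euclid_norm (A *\<^sub>v 0\<^sub>v (dim_col A)) \<le> spectral_norm A"
    unfolding spectral_norm_def
    by (intro cSUP_upper spectral_norm_bdd_above) (auto simp: euclid_norm_def)
  then show ?thesis using euclid_norm_nonneg order_trans by blast
qed

text \<open>If \<open>x = u + v\<close> with \<open>u = P x\<close>, then exchanging the lengths of \<open>u\<close> and \<open>v\<close> gives a vector
  of the same length as \<open>x\<close> whose image under \<open>P\<close> is as long as \<open>v\<close>.\<close>

lemma complementary_projection_bound:
  assumes P: "P \<in> carrier_mat m m" "P * P = P" "P \<noteq> 0\<^sub>m m m"
    and bound: "\<And>x. x \<in> carrier_vec m \<Longrightarrow> euclid_norm (P *\<^sub>v x) \<le> s * euclid_norm x"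
  shows "1 \<le> s"
    and "x \<in> carrier_vec m \<Longrightarrow> euclid_norm (x - P *\<^sub>v x) \<le> s * euclid_norm x"
proof -
  note Pc = mult_mat_vec_carrier[OF P(1)]
  have PP: "P *\<^sub>v (P *\<^sub>v x) = P *\<^sub>v x" if "x \<in> carrier_vec m" for x
    using assoc_mult_mat_vec[OF P(1) P(1) that] P(2) by simp
  have "\<exists>j<m. P *\<^sub>v unit_vec m j \<noteq> 0\<^sub>v m"
  proof (rule ccontr)
    assume a: "\<not> (\<exists>j<m. P *\<^sub>v unit_vec m j \<noteq> 0\<^sub>v m)"
    have "P = 0\<^sub>m m m"
    proof (rule eq_matI)
      fix i j assume ij: "i < dim_row (0\<^sub>m m m :: real mat)" "j < dim_col (0\<^sub>m m m :: real mat)"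
      then have "(P *\<^sub>v unit_vec m j) $ i = 0" using a by simp
      then show "P $$ (i, j) = (0\<^sub>m m m :: real mat) $$ (i, j)" using ij P(1) by simp
    qed (use P in auto)
    then show False using P(3) by simp
  qed
  then obtain j where "P *\<^sub>v unit_vec m j \<noteq> 0\<^sub>v m" by blast
  then have "0 < euclid_norm (P *\<^sub>v unit_vec m j)" by (intro euclid_norm_pos[of _ m]) (auto simp: Pc)
  \<comment> \<open>\<open>P\<close> fixes the nonzero vector \<open>P e_j\<close>, so the bound
    applied there forces \<open>s\<close> to be at least 1.\<close>
  then show s: "1 \<le> s" using bound[of "P *\<^sub>v unit_vec m j"] by (simp add: PP Pc)
  assume x: "x \<in> carrier_vec m"
  define u where "u = P *\<^sub>v x"
  define v where "v = x - u"
  have u[simp]: "u \<in> carrier_vec m" using x by (simp add: u_def Pc)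
  have v[simp]: "v \<in> carrier_vec m" using x by (simp add: v_def)
  have xuv: "x = u + v"
    by (intro eq_vecI) (simp_all add: v_def carrier_vecD[OF x] carrier_vecD[OF u])
  have Pu: "P *\<^sub>v u = u" using x by (simp add: u_def PP)
  have Pv: "P *\<^sub>v v = 0\<^sub>v m"
    unfolding v_def by (subst mult_minus_distrib_mat_vec[OF P(1) x u]) (simp add: Pu flip: u_def)
  have "euclid_norm v \<le> s * euclid_norm x"
  \<comment> \<open>Exchanging the lengths divides by both of them. If \<open>u\<close> vanishes,
    then \<open>v = x\<close> and \<open>1 \<le> s\<close> suffices.\<close>
  proof (cases "u = 0\<^sub>v m \<or> v = 0\<^sub>v m")
    case True
    then show ?thesis
    proof
      assume "u = 0\<^sub>v m"
      then have "v = x" using xuv v by simp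
      then show ?thesis using mult_right_mono[OF s euclid_norm_nonneg[of x]] by simp
    next
      assume "v = 0\<^sub>v m"
      then have "euclid_norm v = 0" by (simp add: euclid_norm_def)
      then show ?thesis using s euclid_norm_nonneg[of x] by simp
    qed
  next
    case False
    define a where "a = euclid_norm u"
    define b where "b = euclid_norm v"
    have ab: "0 < a" "0 < b" using False euclid_norm_pos[OF u] euclid_norm_pos[OF v]
      by (auto simp: a_def b_def)
    have sq: "u \<bullet> u = a\<^sup>2" "v \<bullet> v = b\<^sup>2"
      by (simp_all add: a_def b_def euclid_norm_def scalar_prod_self_nonneg)
    define w where "w = (b / a) \<cdot>\<^sub>v u + (a / b) \<cdot>\<^sub>v v"
    have w[simp]: "w \<in> carrier_vec m" by (simp add: w_def)
    \<comment> \<open>The two squares trade places, and the cross term is unchanged because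
      \<open>(b / a) * (a / b) = 1\<close>.\<close>
    have "w \<bullet> w = x \<bullet> x"
      using ab unfolding w_def xuv
      by (simp add: add_scalar_prod_distrib[of _ m] scalar_prod_add_distrib[of _ m]
          smult_scalar_prod_distrib[of _ m] scalar_prod_smult_distrib[of _ m] sq
          comm_scalar_prod[OF v u] power2_eq_square field_simps)
    then have "euclid_norm w = euclid_norm x" by (simp add: euclid_norm_def)
    moreover have "P *\<^sub>v w = (b / a) \<cdot>\<^sub>v u"
      unfolding w_def
      by (simp add: mult_add_distrib_mat_vec[OF P(1)] mult_mat_vec[OF P(1)] Pu Pv smult_zero_vec)
    ultimately have "\<bar>b / a\<bar> * a \<le> s * euclid_norm x"
      using bound[OF w] by (simp add: euclid_norm_smult flip: a_def)
    then show ?thesis using ab by (simp flip: b_def)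
  qed
  then show "euclid_norm (x - P *\<^sub>v x) \<le> s * euclid_norm x" by (simp add: v_def u_def)
qed

lemma transpose_smult:
  fixes A :: "'a :: semiring_1 mat"
  shows "transpose_mat (c \<cdot>\<^sub>m A) = c \<cdot>\<^sub>m transpose_mat A"
  by (intro eq_matI) auto

lemma orthonormal_cols_transpose:
  assumes "B \<in> carrier_mat m m" "orthonormal_cols B"
  shows "orthonormal_cols (transpose_mat B)"
  using assms mat_mult_left_right_inverse[of "transpose_mat B" m B]
  by (simp add: orthonormal_cols_def)

lemma orthonormal_cols_one: "orthonormal_cols (1\<^sub>m n)"
  by (simp add: orthonormal_cols_def)

lemma contraction_scale:
  assumes B: "B \<in> carrier_mat l l" and s: "0 < s"
    and bound: "\<And>x. x \<in> carrier_vec l \<Longrightarrow> euclid_norm (B *\<^sub>v x) \<le> s * euclid_norm x"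
  shows "contraction ((1 / s) \<cdot>\<^sub>m B)"
  unfolding contraction_def
proof
  fix x :: "real vec" assume "x \<in> carrier_vec (dim_col ((1 / s) \<cdot>\<^sub>m B))"
  then have x: "x \<in> carrier_vec l" using B by simp
  have "euclid_norm (((1 / s) \<cdot>\<^sub>m B) *\<^sub>v x) \<le> euclid_norm x"
    using bound[OF x] s by (simp add: smult_mat_mult_vec[OF B x] euclid_norm_smult field_simps)
  then show "(((1 / s) \<cdot>\<^sub>m B) *\<^sub>v x) \<bullet> (((1 / s) \<cdot>\<^sub>m B) *\<^sub>v x) \<le> x \<bullet> x"
    by (simp add: euclid_norm_def)
qed

context
  fixes m n :: nat and N :: "real mat \<Rightarrow> real"
  assumes N: "unitarily_invariant_norm m n N"
begin

lemma unitarily_invariant_norm_add_le: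
  "A \<in> carrier_mat m n \<Longrightarrow> B \<in> carrier_mat m n \<Longrightarrow> N (A + B) \<le> N A + N B"
  using N unfolding unitarily_invariant_norm_def by blast

lemma unitarily_invariant_norm_smult: "A \<in> carrier_mat m n \<Longrightarrow> N (c \<cdot>\<^sub>m A) = \<bar>c\<bar> * N A"
  using N unfolding unitarily_invariant_norm_def by blast

lemma unitarily_invariant_norm_orthogonal:
  "A \<in> carrier_mat m n \<Longrightarrow> U \<in> carrier_mat m m \<Longrightarrow> V \<in> carrier_mat n n \<Longrightarrow>
    orthonormal_cols U \<Longrightarrow> orthonormal_cols V \<Longrightarrow> N (U * A * V) = N A"
  using N unfolding unitarily_invariant_norm_def by blast

lemma unitarily_invariant_norm_convex_le:
  assumes A: "A \<in> carrier_mat m n" and B: "B \<in> carrier_mat m n"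
    and le: "N A \<le> c" "N B \<le> c" and t: "0 \<le> t" "t \<le> 1"
  shows "N (t \<cdot>\<^sub>m A + (1 - t) \<cdot>\<^sub>m B) \<le> c"
proof -
  have "N (t \<cdot>\<^sub>m A + (1 - t) \<cdot>\<^sub>m B) \<le> N (t \<cdot>\<^sub>m A) + N ((1 - t) \<cdot>\<^sub>m B)"
    using A B by (intro unitarily_invariant_norm_add_le) auto
  also have "\<dots> = t * N A + (1 - t) * N B"
    using A B t by (simp add: unitarily_invariant_norm_smult)
  also have "\<dots> \<le> t * c + (1 - t) * c"
    using le t by (intro add_mono mult_left_mono) auto
  finally show ?thesis by (simp add: algebra_simps)
qed

text \<open>The matrices \<open>B\<close> satisfying this bound form a convex set containing the
  orthogonal ones, hence all contractions.\<close>

lemma unitarily_invariant_norm_contraction_left: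
  assumes B: "B \<in> carrier_mat m m" "contraction B" and E: "E \<in> carrier_mat m n"
  shows "N (B * E) \<le> N E"
  using B
proof (induction rule: contraction_induct)
  case (convex B C t)
  have "(t \<cdot>\<^sub>m B + (1 - t) \<cdot>\<^sub>m C) * E = t \<cdot>\<^sub>m (B * E) + (1 - t) \<cdot>\<^sub>m (C * E)"
    using convex E by (subst add_mult_distrib_mat[of _ m m _ _ n]) (auto simp: mult_smult_assoc_mat)
  then show ?case
    using convex E by (simp add: unitarily_invariant_norm_convex_le)
next
  case (orthogonal B)
  then have "N (B * E * 1\<^sub>m n) = N E"
    using E orthonormal_cols_one by (intro unitarily_invariant_norm_orthogonal) auto
  then show ?case using orthogonal E by simp
qed

text \<open>The transpose sits on \<open>B\<close> so that the induction runs over \<open>B\<close>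
  itself; this avoids showing that transposes of contractions are contractions.\<close>

lemma unitarily_invariant_norm_contraction_right:
  assumes B: "B \<in> carrier_mat n n" "contraction B" and E: "E \<in> carrier_mat m n"
  shows "N (E * transpose_mat B) \<le> N E"
  using B
proof (induction rule: contraction_induct)
  case (convex B C t)
  have "E * transpose_mat (t \<cdot>\<^sub>m B + (1 - t) \<cdot>\<^sub>m C) =
      t \<cdot>\<^sub>m (E * transpose_mat B) + (1 - t) \<cdot>\<^sub>m (E * transpose_mat C)"
    using convex E
    by (simp add: transpose_add[of _ n n] transpose_smult mult_add_distrib_mat[of _ m n _ n]
        mult_smult_distrib[of _ m n _ n])
  then show ?case
    using convex E by (simp add: unitarily_invariant_norm_convex_le)
next
  case (orthogonal B)
  then have "N (1\<^sub>m m * E * transpose_mat B) = N E"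
    using E orthonormal_cols_one orthonormal_cols_transpose[OF orthogonal]
    by (intro unitarily_invariant_norm_orthogonal) auto
  then show ?case using E by simp
qed

text \<open>Dividing the factors by \<open>s\<close> and \<open>t\<close> reduces this to
  contractions. The bounds are stated on vectors because this is how they arise for complementary
  projectors.\<close>

lemma unitarily_invariant_norm_mult_le:
  assumes B: "B \<in> carrier_mat m m" and C: "C \<in> carrier_mat n n" and E: "E \<in> carrier_mat m n"
    and s: "0 < s" "\<And>x. x \<in> carrier_vec m \<Longrightarrow> euclid_norm (B *\<^sub>v x) \<le> s * euclid_norm x"
    and t: "0 < t" "\<And>x. x \<in> carrier_vec n \<Longrightarrow> euclid_norm (C *\<^sub>v x) \<le> t * euclid_norm x"
  shows "N (B * E * transpose_mat C) \<le> s * t * N E"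
proof -
  let ?B = "(1 / s) \<cdot>\<^sub>m B" and ?C = "(1 / t) \<cdot>\<^sub>m C"
  have "?B * E * transpose_mat ?C = (1 / s) \<cdot>\<^sub>m (B * E) * ((1 / t) \<cdot>\<^sub>m transpose_mat C)"
    by (simp add: mult_smult_assoc_mat[OF B E] transpose_smult)
  also have "\<dots> = (1 / s) \<cdot>\<^sub>m (B * E * ((1 / t) \<cdot>\<^sub>m transpose_mat C))"
    using B C E by (intro mult_smult_assoc_mat[of _ m n _ n]) auto
  also have "B * E * ((1 / t) \<cdot>\<^sub>m transpose_mat C) = (1 / t) \<cdot>\<^sub>m (B * E * transpose_mat C)"
    using B C E by (intro mult_smult_distrib[of _ m n _ n]) auto
  finally have "N (?B * E * transpose_mat ?C) = 1 / s * (1 / t * N (B * E * transpose_mat C))"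
    using B C E s(1) t(1) by (simp add: unitarily_invariant_norm_smult)
  then have "N (B * E * transpose_mat C) = s * t * N (?B * E * transpose_mat ?C)"
    using s(1) t(1) by (simp add: field_simps)
  moreover have "N (?B * E * transpose_mat ?C) \<le> N (?B * E)"
    by (rule unitarily_invariant_norm_contraction_right) (use B C E contraction_scale[OF C t] in auto)
  moreover have "N (?B * E) \<le> N E"
    by (rule unitarily_invariant_norm_contraction_left) (use B C E contraction_scale[OF B s] in auto)
  ultimately show ?thesis using s(1) t(1) by simp
qed

end

section \<open>Pseudoinverses\<close>

text \<open>\<open>A B\<close> and \<open>A C\<close> are symmetric and each absorbs the other, so
  they coincide; likewise \<open>B A\<close> and \<open>C A\<close>. Then
  \<open>B = B A B = C A C = C\<close>.\<close>

lemma is_pinv_unique: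
  assumes B: "is_pinv A B" and C: "is_pinv A C"
  shows "B = C"
proof -
  define m n where "m = dim_row A" and "n = dim_col A"
  have A[simp]: "A \<in> carrier_mat m n" and Bc[simp]: "B \<in> carrier_mat n m"
    and Cc[simp]: "C \<in> carrier_mat n m"
    using B C by (auto simp: is_pinv_def m_def n_def)
  note [simp] = mult_carrier_mat[OF A Bc] mult_carrier_mat[OF A Cc]
    mult_carrier_mat[OF Bc A] mult_carrier_mat[OF Cc A]
  have B': "A * B * A = A" "B * A * B = B" "transpose_mat (A * B) = A * B"
      "transpose_mat (B * A) = B * A"
    and C': "A * C * A = A" "C * A * C = C" "transpose_mat (A * C) = A * C"
      "transpose_mat (C * A) = C * A"
    using B C by (auto simp: is_pinv_def)
  have 1: "A * C * (A * B) = A * B"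
    using C'(1) assoc_mult_mat[of "A * C" m m A n B m] by simp
  have "A * B = transpose_mat (A * C * (A * B))" by (simp add: 1 B'(3))
  also have "\<dots> = A * B * (A * C)"
    using B'(3) C'(3) by (subst transpose_mult[of _ m m _ m]) auto
  also have "\<dots> = A * C"
    using B'(1) assoc_mult_mat[of "A * B" m m A n C m] by simp
  finally have AB: "A * B = A * C" .
  have 2: "B * A * (C * A) = B * A"
    using C'(1) assoc_mult_mat[of B n m A n "C * A" n] assoc_mult_mat[of A m n C m A n] by simp
  have "B * A = transpose_mat (B * A * (C * A))" by (simp add: 2 B'(4))
  also have "\<dots> = C * A * (B * A)"
    using B'(4) C'(4) by (subst transpose_mult[of _ n n _ n]) auto
  also have "\<dots> = C * A"
    using B'(1) assoc_mult_mat[of C n m A n "B * A" n] assoc_mult_mat[of A m n B m A n] by simp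
  finally have BA: "B * A = C * A" .
  have "B = B * A * B" by (simp add: B')
  also have "\<dots> = C * A * B" by (simp add: BA)
  also have "\<dots> = C * (A * B)" by (rule assoc_mult_mat[of _ n m _ n _ m]) auto
  also have "\<dots> = C * A * C" by (simp add: AB assoc_mult_mat[of C n m A n C m])
  finally show ?thesis by (simp add: C')
qed

lemma is_pinv_carrier: "is_pinv A B \<Longrightarrow> A \<in> carrier_mat m n \<Longrightarrow> B \<in> carrier_mat n m"
  unfolding is_pinv_def by (metis carrier_matD)

lemma is_pinv_transpose_mult: "is_pinv A B \<Longrightarrow> transpose_mat (A * B) = A * B"
  unfolding is_pinv_def by blast

lemma pinv_eq: "is_pinv A B \<Longrightarrow> pinv A = B"
  unfolding pinv_def by (rule the_equality) (auto intro: is_pinv_unique)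

text \<open>Carries existence over from full column rank to full row rank, as required for
  \<open>X\<close>.\<close>

lemma is_pinv_transpose:
  assumes "is_pinv A B"
  shows "is_pinv (transpose_mat A) (transpose_mat B)"
proof -
  define m n where "m = dim_row A" and "n = dim_col A"
  have A[simp]: "A \<in> carrier_mat m n" and B[simp]: "B \<in> carrier_mat n m"
    using assms by (auto simp: is_pinv_def m_def n_def)
  note [simp] = mult_carrier_mat[OF A B] mult_carrier_mat[OF B A]
  have AB: "transpose_mat A * transpose_mat B = transpose_mat (B * A)"
    and BA: "transpose_mat B * transpose_mat A = transpose_mat (A * B)"
    by (simp_all add: transpose_mult[of _ n m _ n] transpose_mult[of _ m n _ m])
  have "transpose_mat (B * A) * transpose_mat A = transpose_mat (A * (B * A))"
    by (rule transpose_mult[of _ m n _ n, symmetric]) auto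
  moreover have "transpose_mat (A * B) * transpose_mat B = transpose_mat (B * (A * B))"
    by (rule transpose_mult[of _ n m _ m, symmetric]) auto
  moreover have "A * (B * A) = A" "B * (A * B) = B"
    using assms by (auto simp: is_pinv_def assoc_mult_mat[of A m n B m A n]
        assoc_mult_mat[of B n m A n B m])
  ultimately show ?thesis
    using assms by (auto simp: is_pinv_def AB BA)
qed

text \<open>A left inverse satisfies all Penrose conditions except possibly the symmetry of
  \<open>A * B\<close>.\<close>

lemma is_pinv_left_inverse:
  assumes "A \<in> carrier_mat m n" "B \<in> carrier_mat n m" "B * A = 1\<^sub>m n"
    "transpose_mat (A * B) = A * B"
  shows "is_pinv A B"
  using assms assoc_mult_mat[of A m n B m A n] by (auto simp: is_pinv_def)

lemma inverse_of_injective: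
  fixes A :: "real mat"
  assumes A: "A \<in> carrier_mat n n"
    and inj: "\<And>v. v \<in> carrier_vec n \<Longrightarrow> A *\<^sub>v v = 0\<^sub>v n \<Longrightarrow> v = 0\<^sub>v n"
  obtains B where "B \<in> carrier_mat n n" "B * A = 1\<^sub>m n" "A * B = 1\<^sub>m n"
proof -
  have "det A \<noteq> 0" using det_0_iff_vec_prod_zero[OF A] inj by auto
  from det_non_zero_imp_unit[OF A this, of n] that show ?thesis
    by (auto simp: Units_def ring_mat_def)
qed

lemma invertible_mat_left_inverse:
  assumes A: "A \<in> carrier_mat n n" and inv: "invertible_mat A"
  obtains B where "B \<in> carrier_mat n n" "B * A = 1\<^sub>m n"
proof -
  obtain B where B: "A * B = 1\<^sub>m n" "B * A = 1\<^sub>m (dim_row B)"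
    using inv carrier_matD(1)[OF A] unfolding invertible_mat_def inverts_mat_def by metis
  \<comment> \<open>The shape of \<open>B\<close> is read off by comparing column counts in the two
    inverse equations.\<close>
  have dims: "dim_col B = n" "dim_row B = n"
    using arg_cong[OF B(1), of dim_col] arg_cong[OF B(2), of dim_col] carrier_matD(2)[OF A]
    by simp_all
  show ?thesis
  proof (rule that)
    show "B \<in> carrier_mat n n" using dims by (intro carrier_matI)
    show "B * A = 1\<^sub>m n" using B(2) by (simp only: dims)
  qed
qed

text \<open>The pseudoinverse is \<open>L A^T\<close>, where \<open>L\<close> is the inverse of the
  Gram matrix \<open>A^T A\<close>, which exists because \<open>A\<close> is injective.\<close>

lemma injective_is_pinv:
  fixes A :: "real mat"
  assumes A[simp]: "A \<in> carrier_mat m n"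
    and inj: "\<And>v. v \<in> carrier_vec n \<Longrightarrow> A *\<^sub>v v = 0\<^sub>v m \<Longrightarrow> v = 0\<^sub>v n"
  shows "is_pinv A (pinv A)" and "pinv A * A = 1\<^sub>m n"
proof -
  let ?G = "transpose_mat A * A"
  have AT: "transpose_mat A \<in> carrier_mat n m" by simp
  have G[simp]: "?G \<in> carrier_mat n n" by (rule mult_carrier_mat[OF AT A])
  \<comment> \<open>Pairing \<open>A^T A v = 0\<close> with \<open>v\<close> gives squared length 0
    for \<open>A v\<close>.\<close>
  have "v = 0\<^sub>v n" if v: "v \<in> carrier_vec n" and Gv: "?G *\<^sub>v v = 0\<^sub>v n" for v
  proof -
    have Av: "A *\<^sub>v v \<in> carrier_vec m" by (rule mult_mat_vec_carrier[OF A v])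
    have "transpose_mat A *\<^sub>v (A *\<^sub>v v) = 0\<^sub>v n"
      using Gv assoc_mult_mat_vec[of "transpose_mat A" n m A n v] v by simp
    then have "(A *\<^sub>v v) \<bullet> (A *\<^sub>v v) = 0"
      using transpose_vec_mult_scalar[OF A v Av] v by simp
    then show ?thesis using scalar_prod_self_eq_0[OF Av] inj[OF v] by simp
  qed
  then obtain L where L[simp]: "L \<in> carrier_mat n n" and LG: "L * ?G = 1\<^sub>m n" "?G * L = 1\<^sub>m n"
    using inverse_of_injective[OF G] by blast
  have LA[simp]: "L * transpose_mat A \<in> carrier_mat n m" by (rule mult_carrier_mat[OF L AT])
  have "transpose_mat ?G = ?G" by (simp add: transpose_mult[of _ n m _ n])
  \<comment> \<open>By symmetry of the Gram matrix, the transpose of \<open>L\<close> is also a left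
    inverse of it, hence equals \<open>L\<close>; this makes \<open>A L A^T\<close>
    symmetric.\<close>
  then have LTG: "transpose_mat L * ?G = 1\<^sub>m n"
    using LG(2) transpose_mult[OF G L] by simp
  have LT: "transpose_mat L \<in> carrier_mat n n" by simp
  have "transpose_mat L = transpose_mat L * (?G * L)"
    by (simp only: LG(2) right_mult_one_mat[OF LT])
  also have "\<dots> = transpose_mat L * ?G * L" by (rule assoc_mult_mat[OF LT G L, symmetric])
  also have "\<dots> = L" by (simp only: LTG left_mult_one_mat[OF L])
  finally have "transpose_mat L = L" .
  then have sym: "transpose_mat (A * (L * transpose_mat A)) = A * (L * transpose_mat A)"
    by (simp add: transpose_mult[of _ m n _ m] transpose_mult[of _ n n _ m]
        assoc_mult_mat[of A m n L n "transpose_mat A" m])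
  have inv: "L * transpose_mat A * A = 1\<^sub>m n"
    using LG(1) assoc_mult_mat[of L n n "transpose_mat A" m A n] by simp
  have "is_pinv A (L * transpose_mat A)"
    by (rule is_pinv_left_inverse[OF A _ inv sym]) simp
  with pinv_eq[OF this] inv show "is_pinv A (pinv A)" "pinv A * A = 1\<^sub>m n" by simp_all
qed

section \<open>Selection of rows and columns\<close>

text \<open>Turns submatrices into products: it selects rows when multiplied from the left, and its
  transpose selects columns from the right. \<open>pick S i\<close> is the \<open>i\<close>-th
  smallest element of \<open>S\<close>, counted from 0.\<close>

definition selection_mat :: "nat \<Rightarrow> nat set \<Rightarrow> real mat" where
  "selection_mat m S = mat (card S) m (\<lambda>(i, j). if j = pick S i then 1 else 0)"

lemma selection_mat_carrier [simp]: "selection_mat m S \<in> carrier_mat (card S) m"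
  by (simp add: selection_mat_def)

context
  fixes m :: nat and S :: "nat set"
  assumes S: "S \<subseteq> {0..<m}"
begin

text \<open>\<open>pick S\<close> is strictly increasing into the finite set \<open>S\<close>, and
  the cardinalities agree.\<close>

lemma bij_betw_pick: "bij_betw (pick S) {0..<card S} S"
proof -
  have "inj_on (pick S) {0..<card S}"
  proof (rule linorder_inj_onI)
    fix i j assume "i < j" "j \<in> {0..<card S}"
    then have "pick S i < pick S j" using pick_mono_le[of j S i] by simp
    then show "pick S i \<noteq> pick S j" by simp
  qed auto
  moreover have "pick S ` {0..<card S} \<subseteq> S" using pick_in_set_le by auto
  moreover have "finite S" using S finite_subset by blast
  ultimately show ?thesis by (simp add: bij_betw_def card_image card_subset_eq)
qed

lemma pick_less: "i < card S \<Longrightarrow> pick S i < m"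
  using pick_in_set_le[of i S] S by auto

lemma row_selection_mat: "i < card S \<Longrightarrow> row (selection_mat m S) i = unit_vec m (pick S i)"
  by (intro eq_vecI) (auto simp: selection_mat_def pick_less)

text \<open>The left side is the form in which \<open>submatrix\<close> states its
  dimensions.\<close>

lemma card_less_inter: "card {i. i < m \<and> i \<in> S} = card S"
  using S by (intro arg_cong[of _ _ card]) auto

lemma submatrix_rows: "A \<in> carrier_mat m n \<Longrightarrow> submatrix A S UNIV = selection_mat m S * A"
  by (intro eq_matI)
    (auto simp: submatrix_def card_less_inter pick_UNIV row_selection_mat pick_less
      selection_mat_def[THEN arg_cong[of _ _ dim_row]])

lemma submatrix_cols:
  "A \<in> carrier_mat n m \<Longrightarrow> submatrix A UNIV S = A * transpose_mat (selection_mat m S)"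
  by (intro eq_matI)
    (auto simp: submatrix_def card_less_inter pick_UNIV row_selection_mat pick_less
      selection_mat_def[THEN arg_cong[of _ _ dim_row]])

lemma selection_mat_mult_vec_index:
  "x \<in> carrier_vec m \<Longrightarrow> i < card S \<Longrightarrow> (selection_mat m S *\<^sub>v x) $ i = x $ pick S i"
  using carrier_matD[OF selection_mat_carrier[of m S]]
  by (simp add: row_selection_mat pick_less)

lemma euclid_norm_selection_mat_le:
  assumes x: "x \<in> carrier_vec m"
  shows "euclid_norm (selection_mat m S *\<^sub>v x) \<le> euclid_norm x"
proof -
  have "(selection_mat m S *\<^sub>v x) \<bullet> (selection_mat m S *\<^sub>v x) =
      (\<Sum>i\<in>{0..<card S}. x $ pick S i * x $ pick S i)"
    using carrier_matD[OF selection_mat_carrier[of m S]]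
    by (auto simp: scalar_prod_def selection_mat_mult_vec_index[OF x]
        simp del: index_mult_mat_vec intro!: sum.cong)
  also have "\<dots> = (\<Sum>i\<in>S. x $ i * x $ i)"
    by (rule sum.reindex_bij_betw[OF bij_betw_pick])
  also have "\<dots> \<le> x \<bullet> x"
    using S x unfolding scalar_prod_def by (intro sum_mono2) auto
  finally show ?thesis by (simp add: euclid_norm_def)
qed

text \<open>In coordinates, vanishing on \<open>S\<close> passes to subsets of \<open>S\<close> at
  once.\<close>

lemma selection_mat_mult_vec_eq_0:
  assumes x: "x \<in> carrier_vec m"
  shows "selection_mat m S *\<^sub>v x = 0\<^sub>v (card S) \<longleftrightarrow> (\<forall>i \<in> S. x $ i = 0)"
proof -
  have "selection_mat m S *\<^sub>v x = 0\<^sub>v (card S) \<longleftrightarrow> (\<forall>i<card S. x $ pick S i = 0)"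
    using selection_mat_mult_vec_index[OF x] carrier_matD[OF selection_mat_carrier[of m S]]
    by (auto simp: vec_eq_iff simp del: index_mult_mat_vec)
  also have "\<dots> \<longleftrightarrow> (\<forall>i \<in> pick S ` {0..<card S}. x $ i = 0)" by auto
  finally show ?thesis using bij_betw_imp_surj_on[OF bij_betw_pick] by simp
qed

end

lemma submatrix_selection_mat:
  assumes "S \<subseteq> {0..<m}" "J \<subseteq> {0..<n}" "A \<in> carrier_mat m n"
  shows "submatrix A S J = selection_mat m S * (A * transpose_mat (selection_mat n J))"
  unfolding submatrix_split[of A S J] submatrix_cols[OF assms(2,3)]
  by (rule submatrix_rows[OF assms(1)]) (use assms in auto)

section \<open>Oblique projections\<close>

lemma euclid_norm_orthonormal_cols:
  assumes Q: "Q \<in> carrier_mat m k" "orthonormal_cols Q" and x: "x \<in> carrier_vec k"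
  shows "euclid_norm (Q *\<^sub>v x) = euclid_norm x"
proof -
  have Qx: "Q *\<^sub>v x \<in> carrier_vec m" by (rule mult_mat_vec_carrier[OF Q(1) x])
  have "transpose_mat Q *\<^sub>v (Q *\<^sub>v x) = x"
    using Q x assoc_mult_mat_vec[of "transpose_mat Q" k m Q k x] by (simp add: orthonormal_cols_def)
  then show ?thesis
    using transpose_vec_mult_scalar[OF Q(1) x Qx] by (simp add: euclid_norm_def)
qed

lemma oblique_projection_mult:
  fixes Q Y :: "real mat"
  assumes Q: "Q \<in> carrier_mat m k" and Y: "Y \<in> carrier_mat k (card S)"
    and YQ: "Y * (selection_mat m S * Q) = 1\<^sub>m k"
  shows "Q * Y * selection_mat m S * Q = Q"
proof -
  note [simp] = mult_carrier_mat[OF Q Y] mult_carrier_mat[OF selection_mat_carrier[of m S] Q]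
  have "Q * Y * selection_mat m S * Q = Q * Y * (selection_mat m S * Q)"
    using Q Y by (intro assoc_mult_mat[of _ m "card S" _ m _ k]) auto
  also have "\<dots> = Q * (Y * (selection_mat m S * Q))"
    using Q Y by (intro assoc_mult_mat[of _ m k _ "card S" _ k]) auto
  finally show ?thesis using Q YQ by simp
qed

text \<open>The matrix is idempotent because it fixes \<open>Q\<close>. Its norm is at most that of
  \<open>Y\<close>, since \<open>Q\<close> is isometric and selecting coordinates shortens no
  vector. The bound on the complementary projector then applies.\<close>

lemma oblique_projection_bound:
  fixes Q Y :: "real mat"
  assumes Q: "Q \<in> carrier_mat m k" "orthonormal_cols Q" and k: "0 < k"
    and S: "S \<subseteq> {0..<m}" and Y: "Y \<in> carrier_mat k (card S)"
    and YQ: "Y * (selection_mat m S * Q) = 1\<^sub>m k"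
  shows "1 \<le> spectral_norm Y"
    and "x \<in> carrier_vec m \<Longrightarrow>
      euclid_norm (x - (Q * Y * selection_mat m S) *\<^sub>v x) \<le> spectral_norm Y * euclid_norm x"
proof -
  let ?D = "Q * Y * selection_mat m S"
  note [simp] = mult_carrier_mat[OF Q(1) Y] mult_carrier_mat[OF Y selection_mat_carrier[of m S]]
  have D: "?D \<in> carrier_mat m m"
    by (rule mult_carrier_mat[OF mult_carrier_mat[OF Q(1) Y] selection_mat_carrier])
  note mult_Q = oblique_projection_mult[OF Q(1) Y YQ]
  have "?D * ?D = ?D * Q * (Y * selection_mat m S)"
    using D Q Y by (simp add: assoc_mult_mat[of Q m k Y "card S" _ m]
        assoc_mult_mat[of _ m m Q k "Y * selection_mat m S" m])
  also have "\<dots> = ?D"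
    unfolding mult_Q using Q Y by (simp add: assoc_mult_mat[of Q m k Y "card S" _ m])
  finally have DD: "?D * ?D = ?D" .
  \<comment> \<open>A zero projector would give \<open>Q = 0\<close>, contradicting
    \<open>Q^T Q = 1\<close>; with \<open>0 < k\<close> the entry at (0, 0) shows this.\<close>
  have D0: "?D \<noteq> 0\<^sub>m m m"
  proof
    assume "?D = 0\<^sub>m m m"
    then have "Q = 0\<^sub>m m k" using mult_Q Q by simp
    then have "(1\<^sub>m k :: real mat) = 0\<^sub>m k k" using Q by (simp add: orthonormal_cols_def)
    then have "(1\<^sub>m k :: real mat) $$ (0, 0) = 0\<^sub>m k k $$ (0, 0)" by simp
    then show False using k by simp
  qed
  have bound: "euclid_norm (?D *\<^sub>v x) \<le> spectral_norm Y * euclid_norm x"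
    if x: "x \<in> carrier_vec m" for x
  proof -
    have Sx: "selection_mat m S *\<^sub>v x \<in> carrier_vec (card S)"
      by (rule mult_mat_vec_carrier[OF selection_mat_carrier x])
    have "?D *\<^sub>v x = Q *\<^sub>v (Y *\<^sub>v (selection_mat m S *\<^sub>v x))"
      using Q(1) Y x Sx by (simp add: assoc_mult_mat_vec[of _ m "card S" _ m]
          assoc_mult_mat_vec[of _ m k _ "card S"])
    then have "euclid_norm (?D *\<^sub>v x) = euclid_norm (Y *\<^sub>v (selection_mat m S *\<^sub>v x))"
      using euclid_norm_orthonormal_cols[OF Q] mult_mat_vec_carrier[OF Y Sx] by simp
    also have "\<dots> \<le> spectral_norm Y * euclid_norm (selection_mat m S *\<^sub>v x)"
      by (rule euclid_norm_mult_le_spectral_norm[OF Y Sx])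
    also have "\<dots> \<le> spectral_norm Y * euclid_norm x"
      by (rule mult_left_mono[OF euclid_norm_selection_mat_le[OF S x] spectral_norm_nonneg])
    finally show ?thesis .
  qed
  show "1 \<le> spectral_norm Y" by (rule complementary_projection_bound(1)[OF D DD D0 bound])
  show "euclid_norm (x - ?D *\<^sub>v x) \<le> spectral_norm Y * euclid_norm x" if "x \<in> carrier_vec m"
    by (rule complementary_projection_bound(2)[OF D DD D0 bound that])
qed

text \<open>Each column of \<open>C\<close> is a combination of the columns of \<open>Q\<close>; the
  chosen coefficient vectors are the columns of \<open>T\<close>.\<close>

lemma col_space_factor:
  fixes C Q :: "real mat"
  assumes C: "C \<in> carrier_mat m k" and Q: "Q \<in> carrier_mat m l"
    and sub: "vec_space.col_space m C \<subseteq> vec_space.col_space m Q"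
  obtains T where "T \<in> carrier_mat l k" "C = Q * T"
proof -
  have "\<exists>x \<in> carrier_vec l. Q *\<^sub>v x = col C j" if j: "j < k" for j
  proof -
    have "C *\<^sub>v unit_vec k j = col C j" using C j by (intro eq_vecI) auto
    then have "col C j \<in> vec_space.col_space m C"
      unfolding vec_space.col_space_eq[OF C] using C j by (auto intro!: bexI[of _ "unit_vec k j"])
    then show ?thesis using sub Q unfolding vec_space.col_space_eq[OF Q] by auto
  qed
  then obtain x where x: "\<And>j. j < k \<Longrightarrow> x j \<in> carrier_vec l \<and> Q *\<^sub>v x j = col C j" by metis
  let ?T = "mat l k (\<lambda>(i, j). x j $ i)"
  have "C = Q * ?T"
  proof (rule eq_matI)
    fix i j assume ij: "i < dim_row (Q * ?T)" "j < dim_col (Q * ?T)"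
    then have xj: "x j \<in> carrier_vec l" "Q *\<^sub>v x j = col C j" using x by auto
    have "col ?T j = x j" using carrier_vecD[OF xj(1)] ij by (intro eq_vecI) auto
    moreover have "(Q *\<^sub>v x j) $ i = col C j $ i" by (simp only: xj(2))
    ultimately show "C $$ (i, j) = (Q * ?T) $$ (i, j)" using C Q ij by simp
  qed (use C Q in auto)
  then show ?thesis using that[of ?T] by simp
qed

section \<open>Cross approximation\<close>

text \<open>The first conjunct ensures that \<open>the (mat_inverse ...)\<close> is a genuine
  inverse. For \<open>k = 0\<close> the right side would be 0 and the left side \<open>N A\<close>,
  whence \<open>0 < k\<close>.\<close>

theorem corollary3p4:
  fixes A X Q\<^sub>C Q\<^sub>X :: "real mat" and m n k p :: nat and I I\<^sub>0 J :: "nat set"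
    and N :: "real mat \<Rightarrow> real"
  assumes A: "A \<in> carrier_mat m n"
    and I: "I \<subseteq> {0..<m}" "card I = k"
    and J: "J \<subseteq> {0..<n}" "card J = k"
    and k: "0 < k" "k \<le> vec_space.rank m A"
    and X: "X \<in> carrier_mat k n"
    and A_IJ: "invertible_mat (submatrix A I J)"
    and X_J: "vec_space.rank k (submatrix X UNIV J) = k"
    and I0: "I\<^sub>0 \<subseteq> {0..<m}" "I \<inter> I\<^sub>0 = {}" "card I\<^sub>0 = p"
    and QC: "Q\<^sub>C \<in> carrier_mat m k" "orthonormal_cols Q\<^sub>C"
      "vec_space.col_space m Q\<^sub>C = vec_space.col_space m (submatrix A UNIV J)"
    and QX: "Q\<^sub>X \<in> carrier_mat n k" "orthonormal_cols Q\<^sub>X"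
      "vec_space.col_space n Q\<^sub>X = vec_space.col_space n (transpose_mat X)"
    and N: "unitarily_invariant_norm m n N"
  shows "invertible_mat (submatrix Q\<^sub>X J UNIV) \<and>
    N (A - cross_approx A (I \<union> I\<^sub>0) J)
      \<le> spectral_norm (pinv (submatrix Q\<^sub>C (I \<union> I\<^sub>0) UNIV))
        * spectral_norm (the (mat_inverse (submatrix Q\<^sub>X J UNIV)))
        * N (A - A * pinv X * X)"
proof -

  \<comment> \<open>Selection matrices and bases of the column space of \<open>C\<close>\<close>
  define S where "S = I \<union> I\<^sub>0"
  have S: "S \<subseteq> {0..<m}" using I I0 by (simp add: S_def)
  define P\<^sub>I P\<^sub>S P\<^sub>J where "P\<^sub>I = selection_mat m I" and "P\<^sub>S = selection_mat m S"
    and "P\<^sub>J = selection_mat n J"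
  define C where "C = A * transpose_mat P\<^sub>J"
  have [simp]: "P\<^sub>I \<in> carrier_mat k m" "P\<^sub>S \<in> carrier_mat (card S) m" "P\<^sub>J \<in> carrier_mat k n"
    using selection_mat_carrier[of m I] selection_mat_carrier[of n J] I J
    by (simp_all add: P\<^sub>I_def P\<^sub>S_def P\<^sub>J_def)
  \<comment> \<open>Together with \<open>carrier_matD\<close>, the rule \<open>carrier_matI\<close> makes the simplifier loop on any matrix
    whose dimensions are not available as unconditional equations.\<close>
  note assoc_mult_mat[simp del] assoc_mult_mat_vec[simp del]
  note [simp] = A X QC(1) QX(1) carrier_matI carrier_matD[OF A] carrier_matD[OF X]
    carrier_matD[OF QC(1)] carrier_matD[OF QX(1)]
    carrier_matD[OF \<open>P\<^sub>I \<in> _\<close>] carrier_matD[OF \<open>P\<^sub>S \<in> _\<close>] carrier_matD[OF \<open>P\<^sub>J \<in> _\<close>]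
  have C_carrier[simp]: "C \<in> carrier_mat m k" by (simp add: C_def)
  note [simp] = carrier_matD[OF C_carrier]
  have C: "submatrix A UNIV J = C" using submatrix_cols[OF J(1) A] by (simp add: C_def P\<^sub>J_def)
  have W: "submatrix A S J = P\<^sub>S * C" and V: "submatrix A I J = P\<^sub>I * C"
    using submatrix_selection_mat[OF S J(1) A] submatrix_selection_mat[OF I(1) J(1) A]
    by (simp_all add: C_def P\<^sub>S_def P\<^sub>I_def P\<^sub>J_def)
  \<comment> \<open>If \<open>C v\<close> vanishes on \<open>S\<close>, it vanishes on
    \<open>I\<close>, and nonsingularity of \<open>A(I,J)\<close> gives \<open>v = 0\<close>: extra
    rows preserve full column rank.\<close>
  have inj_C: "v = 0\<^sub>v k"
    if v: "v \<in> carrier_vec k" and 0: "P\<^sub>S *\<^sub>v (C *\<^sub>v v) = 0\<^sub>v (card S)" for v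
  proof -
    have Cv: "C *\<^sub>v v \<in> carrier_vec m" by (rule mult_mat_vec_carrier[OF _ v]) simp
    have "\<forall>i \<in> S. (C *\<^sub>v v) $ i = 0"
      using 0 selection_mat_mult_vec_eq_0[OF S Cv] by (simp add: P\<^sub>S_def)
    then have "P\<^sub>I *\<^sub>v (C *\<^sub>v v) = 0\<^sub>v k"
      using selection_mat_mult_vec_eq_0[OF I(1) Cv] I(2) by (simp add: P\<^sub>I_def S_def)
    then have PCv: "(P\<^sub>I * C) *\<^sub>v v = 0\<^sub>v k"
      using v by (simp add: assoc_mult_mat_vec[of _ k m _ k])
    obtain L where L: "L \<in> carrier_mat k k" "L * (P\<^sub>I * C) = 1\<^sub>m k"
    proof (rule invertible_mat_left_inverse)
      show "P\<^sub>I * C \<in> carrier_mat k k" by simp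
      show "invertible_mat (P\<^sub>I * C)" using A_IJ by (simp only: V)
    qed
    have "v = (L * (P\<^sub>I * C)) *\<^sub>v v" by (simp only: L(2) one_mult_mat_vec[OF v])
    also have "\<dots> = L *\<^sub>v ((P\<^sub>I * C) *\<^sub>v v)" by (rule assoc_mult_mat_vec[OF L(1) _ v]) simp
    also have "\<dots> = 0\<^sub>v k" unfolding PCv by (intro eq_vecI) (simp_all add: carrier_matD[OF L(1)])
    finally show ?thesis .
  qed
  obtain T where T[simp]: "T \<in> carrier_mat k k" and CT: "C = Q\<^sub>C * T"
    by (rule col_space_factor[OF C_carrier QC(1)]) (simp_all only: QC(3) C order_refl)
  obtain T' where T'[simp]: "T' \<in> carrier_mat k k" and QT': "Q\<^sub>C = C * T'"
    by (rule col_space_factor[OF QC(1) C_carrier]) (simp_all only: QC(3) C order_refl)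
  note [simp] = carrier_matD[OF T] carrier_matD[OF T']
  \<comment> \<open>\<open>Q\<^sub>C T T' = C T' = Q\<^sub>C\<close>, and orthonormality cancels the
    factor \<open>Q\<^sub>C\<close>.\<close>
  have "T * T' = transpose_mat Q\<^sub>C * Q\<^sub>C * (T * T')"
    using QC by (simp add: orthonormal_cols_def)
  also have "\<dots> = transpose_mat Q\<^sub>C * (Q\<^sub>C * (T * T'))"
    by (rule assoc_mult_mat[of _ k m _ k _ k]) auto
  also have "Q\<^sub>C * (T * T') = Q\<^sub>C * T * T'"
    by (rule assoc_mult_mat[symmetric, of _ m k _ k _ k]) auto
  also have "\<dots> = Q\<^sub>C" by (simp only: CT[symmetric] QT'[symmetric])
  finally have TT': "T * T' = 1\<^sub>m k" using QC by (simp add: orthonormal_cols_def)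
  then have T'T: "T' * T = 1\<^sub>m k" by (rule mat_mult_left_right_inverse[OF T T'])

  \<comment> \<open>Pseudoinverses of \<open>Q\<^sub>C(S,:)\<close> and
    \<open>A(S,J)\<close>\<close>
  define Z where "Z = P\<^sub>S * Q\<^sub>C"
  define Y where "Y = pinv Z"
  have Z[simp]: "Z \<in> carrier_mat (card S) k" by (simp add: Z_def)
  note [simp] = carrier_matD[OF Z]
  have Z_eq: "submatrix Q\<^sub>C S UNIV = Z" using submatrix_rows[OF S QC(1)] by (simp add: Z_def P\<^sub>S_def)
  \<comment> \<open>Since \<open>Q\<^sub>C = C T'\<close>, injectivity is inherited from
    \<open>inj_C\<close> through the invertible \<open>T'\<close>.\<close>
  have inj_Z: "v = 0\<^sub>v k" if v: "v \<in> carrier_vec k" and 0: "Z *\<^sub>v v = 0\<^sub>v (card S)" for v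
  proof -
    have T'v: "T' *\<^sub>v v \<in> carrier_vec k" by (rule mult_mat_vec_carrier[OF T' v])
    have "Z *\<^sub>v v = P\<^sub>S *\<^sub>v (C *\<^sub>v (T' *\<^sub>v v))"
      unfolding Z_def using v QT' assoc_mult_mat_vec[of P\<^sub>S "card S" m Q\<^sub>C k v]
        assoc_mult_mat_vec[of C m k T' k v] by simp
    then have "T' *\<^sub>v v = 0\<^sub>v k" using inj_C[OF T'v] 0 by simp
    then have "T *\<^sub>v (T' *\<^sub>v v) = 0\<^sub>v k" by (intro eq_vecI) (simp_all add: carrier_matD[OF T])
    then show ?thesis using assoc_mult_mat_vec[OF T T' v] TT' v by simp
  qed
  have pinv_Y: "is_pinv Z Y"
    unfolding Y_def using Z inj_Z by (rule injective_is_pinv(1))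
  have YZ: "Y * Z = 1\<^sub>m k"
    unfolding Y_def using Z inj_Z by (rule injective_is_pinv(2))
  have Y[simp]: "Y \<in> carrier_mat k (card S)" by (rule is_pinv_carrier[OF pinv_Y Z])
  note [simp] = carrier_matD[OF Y]
  have W_ZT: "P\<^sub>S * C = Z * T"
    unfolding Z_def CT by (rule assoc_mult_mat[symmetric, of _ "card S" m _ k _ k]) auto
  \<comment> \<open>Reversing the factors is legitimate here: \<open>T' Y\<close> is a left inverse
    of \<open>Z T\<close>, and \<open>Z T T' Y\<close> collapses to the symmetric
    \<open>Z Y\<close>.\<close>
  have pinv_W: "pinv (P\<^sub>S * C) = T' * Y"
  proof (rule pinv_eq, unfold W_ZT, rule is_pinv_left_inverse)
    have "T' * Y * (Z * T) = T' * (Y * (Z * T))"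
      by (rule assoc_mult_mat[of _ k k _ "card S" _ k]) auto
    also have "Y * (Z * T) = Y * Z * T"
      by (rule assoc_mult_mat[symmetric, of _ k "card S" _ k _ k]) auto
    finally show "T' * Y * (Z * T) = 1\<^sub>m k" by (simp add: YZ T'T)
    have "Z * T * (T' * Y) = Z * (T * (T' * Y))"
      by (rule assoc_mult_mat[of _ "card S" k _ k _ "card S"]) auto
    also have "T * (T' * Y) = T * T' * Y"
      by (rule assoc_mult_mat[symmetric, of _ k k _ k _ "card S"]) auto
    finally have "Z * T * (T' * Y) = Z * Y" by (simp add: TT')
    then show "transpose_mat (Z * T * (T' * Y)) = Z * T * (T' * Y)"
      by (simp only: is_pinv_transpose_mult[OF pinv_Y])
  qed auto

  \<comment> \<open>Invertibility of \<open>Q\<^sub>X(J,:)\<close>\<close>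
  define Z\<^sub>X where "Z\<^sub>X = P\<^sub>J * Q\<^sub>X"
  have ZX[simp]: "Z\<^sub>X \<in> carrier_mat k k" by (simp add: Z\<^sub>X_def)
  note [simp] = carrier_matD[OF ZX]
  have ZX_eq: "submatrix Q\<^sub>X J UNIV = Z\<^sub>X"
    using submatrix_rows[OF J(1) QX(1)] by (simp add: Z\<^sub>X_def P\<^sub>J_def)
  have XT: "transpose_mat X \<in> carrier_mat n k" by simp
  obtain R where R[simp]: "R \<in> carrier_mat k k" and XR: "transpose_mat X = Q\<^sub>X * R"
    by (rule col_space_factor[OF XT QX(1)]) (simp_all only: QX(3) order_refl)
  note [simp] = carrier_matD[OF R]
  have XJ: "submatrix X UNIV J = X * transpose_mat P\<^sub>J"
    using submatrix_cols[OF J(1) X] by (simp add: P\<^sub>J_def)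
  \<comment> \<open>The transpose of \<open>X(:,J)\<close> factors as \<open>Z\<^sub>X R\<close>, so
    its nonzero determinant forces that of \<open>Z\<^sub>X\<close> to be nonzero.\<close>
  have "det (X * transpose_mat P\<^sub>J) \<noteq> 0"
    using X_J vec_space.det_rank_iff[of "X * transpose_mat P\<^sub>J" k] by (simp add: XJ)
  moreover have "transpose_mat (X * transpose_mat P\<^sub>J) = P\<^sub>J * (Q\<^sub>X * R)"
    unfolding XR[symmetric] by (subst transpose_mult[of _ k n _ k]) auto
  moreover have "P\<^sub>J * (Q\<^sub>X * R) = Z\<^sub>X * R"
    unfolding Z\<^sub>X_def by (rule assoc_mult_mat[symmetric, of _ k n _ k _ k]) auto
  ultimately have "det (Z\<^sub>X * R) \<noteq> 0"
    using det_transpose[of "X * transpose_mat P\<^sub>J" k] by simp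
  then have det: "det Z\<^sub>X \<noteq> 0" by (simp add: det_mult[OF ZX R])
  obtain Y\<^sub>X where YX_inv: "mat_inverse Z\<^sub>X = Some Y\<^sub>X"
    \<comment> \<open>The argument \<open>()\<close> fills the record extension of
      \<open>ring_mat\<close>, so that both facts concern the same ring.\<close>
    using mat_inverse(1)[OF ZX, of "()"] det_non_zero_imp_unit[OF ZX det, of "()"] by (cases "mat_inverse Z\<^sub>X") auto
  note inverse = mat_inverse(2)[OF ZX YX_inv]
  have YX: "Z\<^sub>X * Y\<^sub>X = 1\<^sub>m k" "Y\<^sub>X * Z\<^sub>X = 1\<^sub>m k"
    by (rule inverse[THEN conjunct1], rule inverse[THEN conjunct2, THEN conjunct1])
  have YXc[simp]: "Y\<^sub>X \<in> carrier_mat k k"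
    by (rule inverse[THEN conjunct2, THEN conjunct2])
  note [simp] = carrier_matD[OF YXc]
  have inv: "invertible_mat Z\<^sub>X"
    unfolding invertible_mat_def inverts_mat_def
    by (intro conjI exI[of _ Y\<^sub>X]) (simp_all add: YX)

  \<comment> \<open>The projector on the right is the transpose of \<open>D\<^sub>X\<close>, so that both have the same shape.\<close>
  define D where "D = Q\<^sub>C * Y * P\<^sub>S"
  define D\<^sub>X where "D\<^sub>X = Q\<^sub>X * Y\<^sub>X * P\<^sub>J"
  have D[simp]: "D \<in> carrier_mat m m" and DX[simp]: "D\<^sub>X \<in> carrier_mat n n"
    by (simp_all add: D_def D\<^sub>X_def)
  note [simp] = carrier_matD[OF D] carrier_matD[OF DX]

  \<comment> \<open>Identities for the two projectors\<close>
  have DQ: "D * Q\<^sub>C = Q\<^sub>C"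
    using oblique_projection_mult[OF QC(1) Y] YZ by (simp add: Z_def P\<^sub>S_def D_def)
  have DXQ: "D\<^sub>X * Q\<^sub>X = Q\<^sub>X"
    using oblique_projection_mult[OF QX(1), of Y\<^sub>X J] YX J by (simp add: Z\<^sub>X_def P\<^sub>J_def D\<^sub>X_def)
  have DC: "D * C = C"
    unfolding CT using assoc_mult_mat[of D m m Q\<^sub>C k T k] DQ by simp
  have "D\<^sub>X * transpose_mat X = transpose_mat X"
    unfolding XR using assoc_mult_mat[of D\<^sub>X n n Q\<^sub>X k R k] DXQ by simp
  then have "transpose_mat (D\<^sub>X * transpose_mat X) = X" by simp
  then have XD: "X * transpose_mat D\<^sub>X = X" using transpose_mult[of D\<^sub>X n n "transpose_mat X" k] by simp
  \<comment> \<open>\<open>A\<close> times the transpose of \<open>P\<^sub>J\<close> is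
    \<open>C\<close>, so the columns of this product lie in the column space of \<open>C\<close>,
    which \<open>D\<close> fixes.\<close>
  have AD: "A * transpose_mat D\<^sub>X = C * transpose_mat (Q\<^sub>X * Y\<^sub>X)"
    unfolding D\<^sub>X_def C_def
    by (subst transpose_mult[of _ n k _ n], simp, simp,
        rule assoc_mult_mat[symmetric, of _ m n _ k _ n]) auto
  have DAD: "D * (A * transpose_mat D\<^sub>X) = A * transpose_mat D\<^sub>X"
    unfolding AD using assoc_mult_mat[of D m m C k "transpose_mat (Q\<^sub>X * Y\<^sub>X)" n] DC by simp
  have cross: "cross_approx A S J = D * A"
  proof -
    have "C * pinv (P\<^sub>S * C) = Q\<^sub>C * Y"
    proof -
      have "C * (T' * Y) = C * T' * Y" by (rule assoc_mult_mat[symmetric, of _ m k _ k _ "card S"]) auto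
      then show ?thesis by (simp add: pinv_W flip: QT')
    qed
    then have "cross_approx A S J = Q\<^sub>C * Y * (P\<^sub>S * A)"
      unfolding cross_approx_def C W using submatrix_rows[OF S A] by (simp add: P\<^sub>S_def)
    also have "\<dots> = D * A"
      unfolding D_def by (rule assoc_mult_mat[symmetric, of _ m "card S" _ m _ n]) auto
    finally show ?thesis .
  qed

  \<comment> \<open>As \<open>pinv\<close> is a definite description, even its shape rests on
    existence. The rows \<open>J\<close> of the transpose of \<open>X\<close> form an invertible
    matrix, so that transpose is injective.\<close>
  have pinv_X[simp]: "pinv X \<in> carrier_mat n k"
  proof -
    have "v = 0\<^sub>v k" if v: "v \<in> carrier_vec k" and 0: "transpose_mat X *\<^sub>v v = 0\<^sub>v n" for v
    proof -
      have "P\<^sub>J *\<^sub>v (transpose_mat X *\<^sub>v v) = 0\<^sub>v k"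
        unfolding 0 using carrier_matD[of P\<^sub>J k n] by (intro eq_vecI) simp_all
      then have "(P\<^sub>J * transpose_mat X) *\<^sub>v v = 0\<^sub>v k"
        using v by (simp add: assoc_mult_mat_vec[of _ k n _ k])
      moreover have "det (P\<^sub>J * transpose_mat X) \<noteq> 0"
        using \<open>det (Z\<^sub>X * R) \<noteq> 0\<close> \<open>P\<^sub>J * (Q\<^sub>X * R) = Z\<^sub>X * R\<close> by (simp add: XR)
      ultimately show ?thesis
        using v det_0_iff_vec_prod_zero[of "P\<^sub>J * transpose_mat X" k] by auto
    qed
    then have "is_pinv (transpose_mat X) (pinv (transpose_mat X))"
      by (intro injective_is_pinv(1)[of _ n k]) auto
    from is_pinv_transpose[OF this] have "is_pinv X (transpose_mat (pinv (transpose_mat X)))" by simp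
    then have "is_pinv X (pinv X)" using pinv_eq by metis
    then show ?thesis by (rule is_pinv_carrier[OF _ X])
  qed
  note [simp] = carrier_matD[OF pinv_X]

  \<comment> \<open>Factorisation of the error\<close>
  let ?F = "A - A * pinv X * X"
  let ?B = "1\<^sub>m m - D" and ?B' = "1\<^sub>m n - D\<^sub>X"
  have AXX: "A * pinv X * X \<in> carrier_mat m n" by simp
  then have F: "?F \<in> carrier_mat m n" by (rule minus_carrier_mat)
  \<comment> \<open>Since \<open>XD\<close> leaves \<open>X\<close> unchanged, the term
    \<open>A * pinv X * X\<close> cancels from \<open>?F * transpose_mat ?B'\<close>.\<close>
  have "A * pinv X * X * transpose_mat D\<^sub>X = A * pinv X * X"
    using assoc_mult_mat[of "A * pinv X" m k X n "transpose_mat D\<^sub>X" n] XD by simp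
  then have "?F * transpose_mat D\<^sub>X = A * transpose_mat D\<^sub>X - A * pinv X * X"
    using minus_mult_distrib_mat[OF A AXX, of "transpose_mat D\<^sub>X" n] by simp
  moreover have "?F * transpose_mat ?B' = ?F - ?F * transpose_mat D\<^sub>X"
    using mult_minus_distrib_mat[OF F, of "1\<^sub>m n" n "transpose_mat D\<^sub>X"] F
    by (simp add: transpose_minus[of _ n n])
  ultimately have FB: "?F * transpose_mat ?B' = A - A * transpose_mat D\<^sub>X"
    by (auto intro!: eq_matI)
  have AP: "A * transpose_mat D\<^sub>X \<in> carrier_mat m n" by simp
  have B: "?B \<in> carrier_mat m m" and B': "?B' \<in> carrier_mat n n"
    and BT: "transpose_mat ?B' \<in> carrier_mat n n"
    by (simp_all add: minus_carrier_mat)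
  \<comment> \<open>By \<open>DAD\<close>, the factor \<open>?B\<close> annihilates
    \<open>A * transpose_mat D\<^sub>X\<close>, which leaves \<open>A - D * A\<close>.\<close>
  have "?B * ?F * transpose_mat ?B' = ?B * (A - A * transpose_mat D\<^sub>X)"
    unfolding FB[symmetric] by (rule assoc_mult_mat[OF B F BT])
  also have "\<dots> = (A - A * transpose_mat D\<^sub>X) - D * (A - A * transpose_mat D\<^sub>X)"
    using minus_mult_distrib_mat[of "1\<^sub>m m" m m D "A - A * transpose_mat D\<^sub>X" n]
      minus_carrier_mat[OF AP, of A] by simp
  also have "D * (A - A * transpose_mat D\<^sub>X) = D * A - A * transpose_mat D\<^sub>X"
    using mult_minus_distrib_mat[OF D A AP] DAD by simp
  also have "(A - A * transpose_mat D\<^sub>X) - (D * A - A * transpose_mat D\<^sub>X) = A - D * A"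
    by (auto intro!: eq_matI)
  finally have decomposition: "A - cross_approx A S J = ?B * ?F * transpose_mat ?B'"
    by (simp add: cross)

  \<comment> \<open>Norm estimate\<close>
  have bound: "1 \<le> spectral_norm Y"
    "euclid_norm (x - D *\<^sub>v x) \<le> spectral_norm Y * euclid_norm x" if "x \<in> carrier_vec m" for x
    using oblique_projection_bound[OF QC(1,2) k(1) S Y] YZ that by (auto simp: Z_def P\<^sub>S_def D_def)
  have bound_X: "1 \<le> spectral_norm Y\<^sub>X"
    "euclid_norm (x - D\<^sub>X *\<^sub>v x) \<le> spectral_norm Y\<^sub>X * euclid_norm x" if "x \<in> carrier_vec n" for x
    using oblique_projection_bound[OF QX(1,2) k(1) J(1), of Y\<^sub>X] YX J that
    by (auto simp: Z\<^sub>X_def P\<^sub>J_def D\<^sub>X_def)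
  have "N (?B * ?F * transpose_mat ?B') \<le> spectral_norm Y * spectral_norm Y\<^sub>X * N ?F"
  proof (rule unitarily_invariant_norm_mult_le[OF N B B' F])
    \<comment> \<open>The zero vector merely discharges the shared premise on
      \<open>x\<close>.\<close>
    show "0 < spectral_norm Y" using bound(1)[of "0\<^sub>v m"] by simp
    show "0 < spectral_norm Y\<^sub>X" using bound_X(1)[of "0\<^sub>v n"] by simp
    show "euclid_norm (?B *\<^sub>v x) \<le> spectral_norm Y * euclid_norm x" if x: "x \<in> carrier_vec m" for x
      using bound(2)[OF x] x minus_mult_distrib_mat_vec[of "1\<^sub>m m" m m D x] by simp
    show "euclid_norm (?B' *\<^sub>v x) \<le> spectral_norm Y\<^sub>X * euclid_norm x" if x: "x \<in> carrier_vec n" for x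
      using bound_X(2)[OF x] x minus_mult_distrib_mat_vec[of "1\<^sub>m n" n n D\<^sub>X x] by simp
  qed
  then show ?thesis
    unfolding S_def[symmetric] Z_eq Y_def[symmetric] ZX_eq YX_inv option.sel decomposition
    using inv by blast
qed

end
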